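(* For every integer $N\geq 2$ the function $$\prod_{n=1}^{N-1}\mathfrak{k}_{(0,\frac{n}{N})}(\tau)^{\frac{-12}{\gcd(12,N-1)}}$$ is a modular form for $\Gamma_0(N)$ of weight $\frac{12(N-1)}{\gcd(12,N-1)}$.
   Context: $\mathfrak{H}=\{\tau\in\mathbb{C}:\mathrm{Im}(\tau)>0\}$ and $q=e^{2\pi i\tau}$, with $q^{s}=e^{2\pi i s\tau}$ for $s\in\mathbb{Q}$. For $(r_1,r_2)\in\mathbb{Q}^2-\mathbb{Z}^2$ the Klein form is the holomorphic, nowhere vanishing function on $\mathfrak{H}$ $$\mathfrak{k}_{(r_1,r_2)}(\tau)=e^{\pi i r_2(r_1-1)}q^{\frac12 r_1(r_1-1)}(1-q_z)\prod_{n=1}^\infty(1-q^nq_z)(1-q^nq_z^{-1})(1-q^n)^{-2},$$ where $q_z=e^{2\pi i z}$ with $z=r_1\tau+r_2$. For an integer $k$, $\alpha=\begin{pmatrix}a&b\\c&d\end{pmatrix}\in\mathrm{SL}_2(\mathbb{Z})$ and a function $f$ on $\mathfrak{H}$, $f(\tau)|[\alpha]_k=(c\tau+d)^{-k}f\big(\frac{a\tau+b}{c\tau+d}\big)$. $\Gamma_0(N)=\{\alpha\in\mathrm{SL}_2(\mathbb{Z}):\alpha\equiv\begin{pmatrix}*&*\\0&*\end{pmatrix}\pmod N\}$. A holomorphic function $f$ on $\mathfrak{H}$ is a modular form for $\Gamma_0(N)$ of weight $k$ if $f|[\gamma]_k=f$ for all $\gamma\in\Gamma_0(N)$ and $f$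 is holomorphic at every cusp (i.e. for every $\alpha\in\mathrm{SL}_2(\mathbb{Z})$, $f|[\alpha]_k$ has an expansion in nonnegative powers of $q^{1/h}$ for some positive integer $h$). *)

theory Defs
  imports "HOL-Complex_Analysis.Complex_Analysis" "HOL-Number_Theory.Cong"
begin

definition upper_half_plane :: "complex set" where
  "upper_half_plane = {\<tau>. Im \<tau> > 0}"

text \<open>The power $q^s$, where $q = e^{2 \pi i \tau}$, for rational $s$.\<close>

definition qpow :: "complex \<Rightarrow> rat \<Rightarrow> complex" where
  "qpow \<tau> s = exp (2 * of_real pi * \<i> * of_rat s * \<tau>)"

text \<open>
  The Klein form $k_{(r_1,r_2)}$. It is only meant to be used if $r_1$ and $r_2$ are not both
  integers and $\tau$ lies in the upper half plane.
  The infinite product starts at $n = 1$, hence the shift to \<open>Suc n\<close>.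
\<close>

definition klein_form :: "rat \<Rightarrow> rat \<Rightarrow> complex \<Rightarrow> complex" where
  "klein_form r1 r2 \<tau> =
     (let q = qpow \<tau> 1;
          z = of_rat r1 * \<tau> + of_rat r2;
          qz = exp (2 * of_real pi * \<i> * z)
      in exp (of_real pi * \<i> * of_rat (r2 * (r1 - 1))) * qpow \<tau> (r1 * (r1 - 1) / 2) * (1 - qz) *
         (\<Prod>n. (1 - q ^ Suc n * qz) * (1 - q ^ Suc n * inverse qz) * (1 - q ^ Suc n) powi (-2)))"

definition SL2Z :: "(int ^ 2 ^ 2) set" where
  "SL2Z = {A. det A = 1}"

text \<open>Here \<open>A $ i $ j\<close> is the entry in row \<open>i\<close>, column \<open>j\<close>.\<close>

definition Gamma0 :: "int \<Rightarrow> (int ^ 2 ^ 2) set" where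
  "Gamma0 N = {A \<in> SL2Z. [A $ 2 $ 1 = 0] (mod N)}"

definition slash :: "(complex \<Rightarrow> complex) \<Rightarrow> int ^ 2 ^ 2 \<Rightarrow> int \<Rightarrow> complex \<Rightarrow> complex" where
  "slash f A k \<tau> =
     (of_int (A $ 2 $ 1) * \<tau> + of_int (A $ 2 $ 2)) powi (- k) *
     f ((of_int (A $ 1 $ 1) * \<tau> + of_int (A $ 1 $ 2)) /
        (of_int (A $ 2 $ 1) * \<tau> + of_int (A $ 2 $ 2)))"

text \<open>An expansion in nonnegative powers of $q^{1/h}$, valid on the whole upper half plane.\<close>

definition has_q_expansion :: "(complex \<Rightarrow> complex) \<Rightarrow> bool" where
  "has_q_expansion g \<longleftrightarrow>
     (\<exists>h::nat. h > 0 \<and> (\<exists>c :: nat \<Rightarrow> complex. \<forall>\<tau>\<in>upper_half_plane.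
        (\<lambda>n. c n * qpow \<tau> (of_nat n / of_nat h)) sums g \<tau>))"

definition modular_form_Gamma0 :: "int \<Rightarrow> int \<Rightarrow> (complex \<Rightarrow> complex) \<Rightarrow> bool" where
  "modular_form_Gamma0 N k f \<longleftrightarrow>
     f holomorphic_on upper_half_plane \<and>
     (\<forall>A\<in>Gamma0 N. \<forall>\<tau>\<in>upper_half_plane. slash f A k \<tau> = f \<tau>) \<and>
     (\<forall>A\<in>SL2Z. has_q_expansion (slash f A k))"

end

theory Submission
  imports Defs "HOL-Number_Theory.Modular_Inverse"
begin

text \<open>
  Write \<open>e x\<close> for \<open>exp (2 \<pi> \<i> x)\<close>. The Klein form with index \<open>(r1, r2)\<close> is \<open>e (r1 * z / 2)\<close> times the
  value at \<open>z = r1 * \<tau> + r2\<close> of a sigma function \<open>klein_sigma z \<tau>\<close>, an entire odd function of \<open>z\<close> with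
  zeros exactly at the points of the lattice \<open>\<int>\<tau> + \<int>\<close> and with explicit exponential multipliers under
  translation by the lattice.

  The heart of the proof is the transformation law of \<open>klein_sigma\<close> under the modular group
  (\<open>klein_sigma_mobius\<close>). It needs neither theta series nor the eta function: an entire function with
  the multipliers of \<open>klein_sigma\<close>, and with the same value and derivative at \<open>0\<close>, is equal to it, by
  Liouville's theorem applied to the quotient (\<open>theta_quasi_periodic_unique\<close>), and the transformed
  function meets these conditions.

  It follows that a matrix of determinant \<open>1\<close> sends the Klein form with index \<open>r\<close> to the one with
  index \<open>r A\<close>, with weight \<open>- 1\<close> (\<open>klein_form_mobius\<close>), and that integral translations of the
  index only cost a constant (\<open>klein_form_translate\<close>). The rest is bookkeeping for the product over
  the indices \<open>(0, n / N)\<close> with \<open>0 < n < N\<close>.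

  Invariance: for a matrix in \<open>\<Gamma>\<^sub>0(N)\<close> the indices are permuted modulo integers by
  \<open>n \<mapsto> d * n mod N\<close>. The product of the constants is computed from the sums of \<open>n\<close>, \<open>n\<^sup>2\<close> and
  \<open>\<lfloor>d * n / N\<rfloor>\<close>; it becomes \<open>1\<close> after raising to the power \<open>12 / gcd 12 (N - 1)\<close>.

  Cusps: for every matrix in \<open>SL\<^sub>2(\<int>)\<close> the transformed product consists of reciprocals of Klein forms
  with nonintegral index. The leading exponent of such a Klein form, after translating \<open>r1\<close> to
  \<open>0 \<le> r1 < 1\<close>, is \<open>r1 * (r1 - 1) / 2 \<le> 0\<close>. Hence the reciprocal is a holomorphic function of a root of
  \<open>q\<close> on the unit disc, which yields the expansion at the cusp.
\<close>

(* The entries of a matrix are written with a symbol that formal power series claim as well. *)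
unbundle no fps_syntax

section \<open>Infinite q-products\<close>

definition qpoch :: "complex \<Rightarrow> complex \<Rightarrow> complex" where
  "qpoch a p = (\<Prod>n. 1 - a * p ^ n)"

lemma convergent_prod_qpoch:
  fixes a p :: complex
  assumes "norm p < 1"
  shows "convergent_prod (\<lambda>n. 1 - a * p ^ n)"
proof -
  have "summable (\<lambda>n. norm a * norm p ^ n)"
    by (intro summable_mult summable_geometric) (use assms in simp)
  then have "abs_convergent_prod (\<lambda>n. 1 - a * p ^ n)"
    by (simp add: abs_convergent_prod_conv_summable norm_mult norm_power)
  then show ?thesis by (rule abs_convergent_prod_imp_convergent_prod)
qed

lemma qpoch_LIMSEQ:
  assumes "norm p < 1"
  shows "(\<lambda>N. \<Prod>n<N. 1 - a * p ^ n) \<longlonglongrightarrow> qpoch a p"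
proof -
  have "(\<lambda>N. \<Prod>n<Suc N. 1 - a * p ^ n) \<longlonglongrightarrow> qpoch a p"
    using convergent_prod_LIMSEQ[OF convergent_prod_qpoch[OF assms]]
    unfolding qpoch_def lessThan_Suc_atMost .
  then show ?thesis by (rule LIMSEQ_imp_Suc)
qed

lemma qpoch_step:
  assumes "norm p < 1"
  shows "qpoch a p = (1 - a) * qpoch (a * p) p"
proof -
  have "(\<lambda>N. \<Prod>n<Suc N. 1 - a * p ^ n) \<longlonglongrightarrow> qpoch a p"
    by (rule LIMSEQ_Suc[OF qpoch_LIMSEQ[OF assms]])
  also have "(\<lambda>N. \<Prod>n<Suc N. 1 - a * p ^ n) = (\<lambda>N. (1 - a) * (\<Prod>n<N. 1 - (a * p) * p ^ n))"
    by (rule ext, subst prod.lessThan_Suc_shift) (simp add: mult_ac)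
  finally show ?thesis
    by (rule LIMSEQ_unique) (intro tendsto_mult_left qpoch_LIMSEQ assms)
qed

lemma qpoch_eq_0_iff:
  assumes "norm p < 1"
  shows "qpoch a p = 0 \<longleftrightarrow> (\<exists>n. a * p ^ n = 1)"
proof -
  have "(\<lambda>n. 1 - a * p ^ n) has_prod qpoch a p"
    unfolding qpoch_def by (rule convergent_prod_has_prod[OF convergent_prod_qpoch[OF assms]])
  from has_prod_eq_0_iff[OF this] show ?thesis by (auto simp: image_iff)
qed

text \<open>
  Both variables are allowed to depend on the parameter: the product is used as an entire function
  of the elliptic variable with fixed \<open>p\<close>, and as a function of a root of \<open>q\<close>, on which both \<open>a\<close> and
  \<open>p\<close> then depend. On a small closed ball the factors are dominated by a geometric series.
\<close>

lemma holomorphic_qpoch: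
  assumes S: "open S" and a: "a holomorphic_on S" and p: "p holomorphic_on S"
    and less: "\<And>w. w \<in> S \<Longrightarrow> norm (p w) < 1"
  shows "(\<lambda>w. qpoch (a w) (p w)) holomorphic_on S"
proof (rule holomorphic_uniform_sequence[OF S])
  show "(\<lambda>w. \<Prod>n<N. 1 - a w * p w ^ n) holomorphic_on S" for N
    by (intro holomorphic_intros a p)
  fix x assume "x \<in> S"
  then obtain d where d: "d > 0" "cball x d \<subseteq> S"
    using S open_contains_cball by blast
  have cont: "continuous_on (cball x d) a" "continuous_on (cball x d) p"
    using a p d holomorphic_on_imp_continuous_on holomorphic_on_subset by blast+
  obtain y where y: "y \<in> cball x d" "\<And>w. w \<in> cball x d \<Longrightarrow> norm (p w) \<le> norm (p y)"
    using continuous_attains_sup[of "cball x d" "\<lambda>w. norm (p w)"]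
      continuous_on_norm[OF cont(2)] d(1) by force
  obtain y' where y': "\<And>w. w \<in> cball x d \<Longrightarrow> norm (a w) \<le> norm (a y')"
    using continuous_attains_sup[of "cball x d" "\<lambda>w. norm (a w)"]
      continuous_on_norm[OF cont(1)] d(1) by force
  have "uniformly_convergent_on (cball x d) (\<lambda>N w. \<Sum>n<N. norm (- (a w * p w ^ n)))"
  proof (rule Weierstrass_m_test'_ev)
    show "\<forall>\<^sub>F n in sequentially. \<forall>w\<in>cball x d.
            norm (norm (- (a w * p w ^ n))) \<le> norm (a y') * norm (p y) ^ n"
      by (intro always_eventually allI ballI)
        (auto simp: norm_mult norm_power intro!: mult_mono power_mono y y')
    show "summable (\<lambda>n. norm (a y') * norm (p y) ^ n)"
      using less[of y] y d by (intro summable_mult summable_geometric) auto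
  qed
  then have "uniformly_convergent_on (cball x d) (\<lambda>N w. \<Prod>n<N. 1 + - (a w * p w ^ n))"
    by (intro uniformly_convergent_on_prod continuous_intros cont) auto
  then obtain l where l: "uniform_limit (cball x d) (\<lambda>N w. \<Prod>n<N. 1 - a w * p w ^ n) l sequentially"
    by (auto simp: uniformly_convergent_on_def)
  moreover have "l w = qpoch (a w) (p w)" if "w \<in> cball x d" for w
    using tendsto_uniform_limitI[OF l that] qpoch_LIMSEQ[OF less] d(2) that
    by (blast intro: LIMSEQ_unique)
  ultimately have "uniform_limit (cball x d) (\<lambda>N w. \<Prod>n<N. 1 - a w * p w ^ n)
                     (\<lambda>w. qpoch (a w) (p w)) sequentially"
    by (subst (asm) uniform_limit_cong'[where g = "\<lambda>N w. \<Prod>n<N. 1 - a w * p w ^ n"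
          and i = "\<lambda>w. qpoch (a w) (p w)"]) auto
  with d show "\<exists>d>0. cball x d \<subseteq> S \<and> uniform_limit (cball x d)
                 (\<lambda>N w. \<Prod>n<N. 1 - a w * p w ^ n) (\<lambda>w. qpoch (a w) (p w)) sequentially"
    by blast
qed

section \<open>The exponential function with period one\<close>

definition e :: "complex \<Rightarrow> complex" where
  "e x = exp (2 * of_real pi * \<i> * x)"

lemma e_add: "e (x + y) = e x * e y"
  by (simp add: e_def exp_add algebra_simps)

lemma e_minus: "e (- x) = inverse (e x)"
  by (simp add: e_def exp_minus)

lemma e_diff: "e (x - y) = e x / e y"
  by (simp add: e_def exp_diff algebra_simps)

lemma e_nonzero [simp]: "e x \<noteq> 0"
  by (simp add: e_def)

lemma e_0 [simp]: "e 0 = 1"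
  by (simp add: e_def)

lemma e_eq_1_iff: "e x = 1 \<longleftrightarrow> x \<in> \<int>"
proof
  assume "e x = 1"
  then obtain n :: int where n: "2 * of_real pi * \<i> * x = of_int (2 * n) * pi * \<i>"
    unfolding e_def exp_eq_1 by (auto simp: complex_eq_iff)
  then have "x = of_int n" by (simp add: field_simps)
  then show "x \<in> \<int>" by simp
next
  assume "x \<in> \<int>"
  then obtain n where "x = of_int n" by (elim Ints_cases)
  then show "e x = 1" by (auto simp: e_def exp_eq_1)
qed

lemma e_of_int [simp]: "e (of_int n) = 1"
  by (simp add: e_eq_1_iff)

lemma e_half: "e (1 / 2) = - 1"
  by (simp add: e_def)

lemma e_power: "e x ^ n = e (of_nat n * x)"
  by (simp add: e_def mult_ac flip: exp_of_nat_mult)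

lemma e_powi: "e x powi n = e (of_int n * x)"
  by (simp add: e_def exp_power_int mult_ac)

lemma norm_e: "norm (e x) = exp (- (2 * pi * Im x))"
  by (simp add: e_def)

lemma norm_e_less_1: "Im \<tau> > 0 \<Longrightarrow> norm (e \<tau>) < 1"
  by (simp add: norm_e)

lemma holomorphic_on_e [holomorphic_intros]:
  "f holomorphic_on S \<Longrightarrow> (\<lambda>z. e (f z)) holomorphic_on S"
  unfolding e_def by (intro holomorphic_intros)

lemma DERIV_e: "(e has_field_derivative 2 * of_real pi * \<i> * e z) (at z)"
  unfolding e_def by (auto intro!: derivative_eq_intros)

section \<open>The sigma function of a lattice as a product\<close>

text \<open>
  Up to a constant, this is the quotient of Jacobi's first theta function by the cube of Dedekind's
  eta function, and up to a further factor of the form \<open>exp (c * z\<^sup>2)\<close> the Weierstrass sigma function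
  of the lattice \<open>\<int>\<tau> + \<int>\<close>. The factor \<open>e (- z / 2)\<close> makes it odd.
\<close>

definition klein_sigma :: "complex \<Rightarrow> complex \<Rightarrow> complex" where
  "klein_sigma z \<tau> = e (- z / 2) * qpoch (e z) (e \<tau>) * qpoch (e (\<tau> - z)) (e \<tau>) / qpoch (e \<tau>) (e \<tau>) ^ 2"

lemma qpoch_self_nonzero:
  assumes "Im \<tau> > 0" shows "qpoch (e \<tau>) (e \<tau>) \<noteq> 0"
proof
  assume "qpoch (e \<tau>) (e \<tau>) = 0"
  then obtain n where "e \<tau> * e \<tau> ^ n = 1"
    using qpoch_eq_0_iff[OF norm_e_less_1[OF assms]] by auto
  then have "norm (e \<tau>) ^ Suc n = 1"
    by (metis norm_one norm_power power_Suc)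
  moreover have "norm (e \<tau>) ^ Suc n < 1"
    using norm_e_less_1[OF assms] power_Suc_less_one[of "norm (e \<tau>)"] by (simp del: power_Suc)
  ultimately show False by simp
qed

lemma klein_sigma_plus_1: "klein_sigma (z + 1) \<tau> = e (1 / 2) * klein_sigma z \<tau>"
proof -
  have "e (- z / 2) * e (1 / 2) * inverse (e (of_int 1)) = e (- z / 2 + 1 / 2 + - of_int 1)"
    by (simp only: e_add e_minus)
  also have "- z / 2 + 1 / 2 + - of_int 1 = - (z + 1) / 2"
    by (simp add: field_simps)
  finally have "e (- (z + 1) / 2) = e (- z / 2) * e (1 / 2) * inverse (e (of_int 1))" ..
  moreover have "e (z + 1) = e z" "e (\<tau> - (z + 1)) = e (\<tau> - z)"
    using e_of_int[of 1] by (simp_all add: e_add e_diff)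
  ultimately show ?thesis by (simp only: klein_sigma_def e_of_int) simp
qed

lemma klein_sigma_plus_tau:
  assumes "Im \<tau> > 0"
  shows "klein_sigma (z + \<tau>) \<tau> = e (1 / 2 - \<tau> / 2 - z) * klein_sigma z \<tau>"
proof -
  note q = norm_e_less_1[OF assms]
  define X where "X = qpoch (e (z + \<tau>)) (e \<tau>)"
  define Y where "Y = qpoch (e (\<tau> - z)) (e \<tau>)"
  have 1: "qpoch (e z) (e \<tau>) = (1 - e z) * X"
    using qpoch_step[OF q, of "e z"] by (simp only: X_def e_add)
  have "e (- z) * e \<tau> = e (\<tau> - z)"
    unfolding e_add[symmetric] by (rule arg_cong[where f = e]) simp
  then have "qpoch (e (- z)) (e \<tau>) = (1 - e (- z)) * Y"
    using qpoch_step[OF q, of "e (- z)"] by (simp only: Y_def)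
  moreover have "\<tau> - (z + \<tau>) = - z" by simp
  ultimately have 2: "qpoch (e (\<tau> - (z + \<tau>))) (e \<tau>) = (1 - inverse (e z)) * Y"
    by (simp only: e_minus)
  have 3: "e (- (z + \<tau>) / 2) = e (- z / 2) / e (\<tau> / 2)"
    unfolding e_diff[symmetric] by (rule arg_cong[where f = e]) (simp add: field_simps)
  have 4: "e (1 / 2 - \<tau> / 2 - z) = - 1 / (e (\<tau> / 2) * e z)"
    by (simp add: e_diff e_half)
  show ?thesis
    unfolding klein_sigma_def 1 2 3 4 X_def[symmetric] Y_def[symmetric]
    by (simp add: divide_simps) (simp add: algebra_simps)
qed

text \<open>
  The multipliers of the function \<open>klein_sigma z \<tau>\<close> of \<open>z\<close> under the two basic periods. They are
  abstracted because the modular substitution produces a second function with these multipliers. The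
  sign \<open>- 1\<close> is written as \<open>e (1 / 2)\<close>, so that multipliers compose by adding exponents.
\<close>

definition theta_quasi_periodic :: "complex \<Rightarrow> (complex \<Rightarrow> complex) \<Rightarrow> bool" where
  "theta_quasi_periodic \<tau> f \<longleftrightarrow>
     (\<forall>z. f (z + 1) = e (1 / 2) * f z) \<and> (\<forall>z. f (z + \<tau>) = e (1 / 2 - \<tau> / 2 - z) * f z)"

lemma theta_quasi_periodic_klein_sigma:
  "Im \<tau> > 0 \<Longrightarrow> theta_quasi_periodic \<tau> (\<lambda>z. klein_sigma z \<tau>)"
  by (simp add: theta_quasi_periodic_def klein_sigma_plus_1 klein_sigma_plus_tau)

lemma theta_quasi_periodic_plus_int:
  assumes "theta_quasi_periodic \<tau> f"
  shows "f (z + of_int n) = e (of_int n / 2) * f z"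
proof -
  have step: "f (w + 1) = e (1 / 2) * f w" for w
    using assms by (simp add: theta_quasi_periodic_def)
  show ?thesis
  proof (induction n rule: int_induct[where k = 0])
    case (step1 n)
    then show ?case using step[of "z + of_int n"]
      by (simp add: add_ac add_divide_distrib e_add)
  next
    case (step2 n)
    then show ?case using step[of "z + of_int (n - 1)"]
      by (simp add: algebra_simps diff_divide_distrib e_diff)
  qed simp
qed

lemma theta_quasi_periodic_plus_int_tau:
  assumes "theta_quasi_periodic \<tau> f"
  shows "f (z + of_int m * \<tau>) = e (of_int m / 2 - of_int m ^ 2 * \<tau> / 2 - of_int m * z) * f z"
proof -
  have step: "f (w + \<tau>) = e (1 / 2 - \<tau> / 2 - w) * f w" for w
    using assms by (simp add: theta_quasi_periodic_def)
  define g where "g m = e (of_int m / 2 - of_int m ^ 2 * \<tau> / 2 - of_int m * z)" for m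
  have g: "g (m + 1) = e (1 / 2 - \<tau> / 2 - (z + of_int m * \<tau>)) * g m" for m
    unfolding g_def e_add[symmetric]
    by (rule arg_cong[where f = e]) (simp add: field_simps power2_eq_square)
  have shift: "f (z + of_int (m + 1) * \<tau>) =
                 e (1 / 2 - \<tau> / 2 - (z + of_int m * \<tau>)) * f (z + of_int m * \<tau>)" for m
    using step[of "z + of_int m * \<tau>"] by (simp add: algebra_simps)
  have "f (z + of_int m * \<tau>) = g m * f z"
  proof (induction m rule: int_induct[where k = 0])
    case base
    show ?case by (simp add: g_def)
  next
    case (step1 m)
    then show ?case by (simp only: shift g mult.assoc)
  next
    case (step2 m)
    then show ?case using shift[of "m - 1"] g[of "m - 1"] by simp
  qed
  then show ?thesis by (simp only: g_def)
qed

lemma theta_quasi_periodic_plus_lattice: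
  assumes "theta_quasi_periodic \<tau> f"
  shows "f (z + of_int m * \<tau> + of_int n) =
           e ((of_int m + of_int n) / 2 - of_int m ^ 2 * \<tau> / 2 - of_int m * z) * f z"
proof -
  have "f (z + of_int m * \<tau> + of_int n) =
          e (of_int n / 2) * e (of_int m / 2 - of_int m ^ 2 * \<tau> / 2 - of_int m * z) * f z"
    by (simp only: theta_quasi_periodic_plus_int[OF assms]
          theta_quasi_periodic_plus_int_tau[OF assms] mult.assoc)
  also have "e (of_int n / 2) * e (of_int m / 2 - of_int m ^ 2 * \<tau> / 2 - of_int m * z) =
               e ((of_int m + of_int n) / 2 - of_int m ^ 2 * \<tau> / 2 - of_int m * z)"
    unfolding e_add[symmetric]
    by (rule arg_cong[where f = e]) (simp add: field_simps)
  finally show ?thesis .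
qed

lemmas klein_sigma_plus_lattice = theta_quasi_periodic_plus_lattice[OF theta_quasi_periodic_klein_sigma]

text \<open>
  The zeros can be read off from the linear factors of the product. That all lattice points are zeros
  follows from the multipliers and from the zero at \<open>0\<close>.
\<close>

lemma klein_sigma_eq_0D:
  assumes \<tau>: "Im \<tau> > 0" and "klein_sigma z \<tau> = 0"
  shows "\<exists>m n. z = of_int m * \<tau> + of_int n"
proof -
  note q = norm_e_less_1[OF \<tau>]
  consider "qpoch (e z) (e \<tau>) = 0" | "qpoch (e (\<tau> - z)) (e \<tau>) = 0"
    using assms qpoch_self_nonzero[OF \<tau>] by (auto simp: klein_sigma_def)
  then show ?thesis
  proof cases
    case 1
    then obtain k where "e z * e \<tau> ^ k = 1" using qpoch_eq_0_iff[OF q] by auto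
    then obtain n where "z + of_nat k * \<tau> = of_int n"
      by (auto simp: e_power e_eq_1_iff elim: Ints_cases simp flip: e_add)
    then have "z = of_int (- int k) * \<tau> + of_int n" by (simp add: algebra_simps)
    then show ?thesis by blast
  next
    case 2
    then obtain k where "e (\<tau> - z) * e \<tau> ^ k = 1" using qpoch_eq_0_iff[OF q] by auto
    then obtain n where "\<tau> - z + of_nat k * \<tau> = of_int n"
      by (auto simp: e_power e_eq_1_iff elim: Ints_cases simp flip: e_add)
    then have "z = of_int (int k + 1) * \<tau> + of_int (- n)" by (simp add: algebra_simps)
    then show ?thesis by blast
  qed
qed

lemma holomorphic_klein_sigma:
  assumes "Im \<tau> > 0" shows "(\<lambda>z. klein_sigma z \<tau>) holomorphic_on S"
proof -
  have "(\<lambda>z. klein_sigma z \<tau>) holomorphic_on UNIV"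
    unfolding klein_sigma_def using norm_e_less_1[OF assms] qpoch_self_nonzero[OF assms]
    by (intro holomorphic_intros holomorphic_qpoch) auto
  then show ?thesis by (rule holomorphic_on_subset) simp
qed

text \<open>
  The value does not depend on \<open>\<tau>\<close>: this is the effect of dividing by the square of
  \<open>\<Prod>n. 1 - q ^ Suc n\<close>, and it is what fixes the constant in the transformation law.
\<close>

lemma DERIV_klein_sigma_0:
  assumes "Im \<tau> > 0"
  shows "((\<lambda>z. klein_sigma z \<tau>) has_field_derivative - (2 * of_real pi * \<i>)) (at 0)"
proof -
  note q = norm_e_less_1[OF assms]
  define M where "M z = e (- z / 2) * qpoch (e (z + \<tau>)) (e \<tau>) * qpoch (e (\<tau> - z)) (e \<tau>) / qpoch (e \<tau>) (e \<tau>) ^ 2" for z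
  have "M holomorphic_on UNIV"
    unfolding M_def using q qpoch_self_nonzero[OF assms]
    by (intro holomorphic_intros holomorphic_qpoch) auto
  then have M: "(M has_field_derivative deriv M 0) (at 0)"
    by (rule holomorphic_derivI) auto
  have M0: "M 0 = 1"
    using qpoch_self_nonzero[OF assms] by (simp add: M_def power2_eq_square)
  have eq: "(\<lambda>z. klein_sigma z \<tau>) = (\<lambda>z. (1 - e z) * M z)"
  proof
    fix z
    have "qpoch (e z) (e \<tau>) = (1 - e z) * qpoch (e (z + \<tau>)) (e \<tau>)"
      using qpoch_step[OF q, of "e z"] by (simp only: e_add)
    then show "klein_sigma z \<tau> = (1 - e z) * M z" by (simp add: klein_sigma_def M_def)
  qed
  have "((\<lambda>z. (1 - e z) * M z) has_field_derivative
          (0 - 2 * of_real pi * \<i> * e 0) * M 0 + deriv M 0 * (1 - e 0)) (at 0)"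
    by (intro DERIV_mult DERIV_diff DERIV_const DERIV_e M)
  then show ?thesis by (simp add: eq M0)
qed

section \<open>Uniqueness of the sigma function and its modular transformation\<close>

lemma klein_sigma_0: "Im \<tau> > 0 \<Longrightarrow> klein_sigma 0 \<tau> = 0"
  using qpoch_step[OF norm_e_less_1, of \<tau> 1] by (simp add: klein_sigma_def)

text \<open>
  All values are already taken on the compact fundamental parallelogram.
\<close>

lemma bounded_range_lattice_periodic:
  fixes f :: "complex \<Rightarrow> complex"
  assumes \<tau>: "Im \<tau> > 0" and cont: "continuous_on UNIV f"
    and per: "\<And>z m n. f (z + of_int m * \<tau> + of_int n) = f z"
  shows "bounded (range f)"
proof -
  define P where "P = (\<lambda>(s, t). of_real s * \<tau> + of_real t) ` ({0..1} \<times> {0..1})"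
  have "compact P"
    unfolding P_def case_prod_unfold
    by (intro compact_continuous_image compact_Times continuous_intros) auto
  then have "bounded (f ` P)"
    by (intro compact_imp_bounded compact_continuous_image continuous_on_subset[OF cont]) auto
  moreover have "range f \<subseteq> f ` P"
  proof (rule image_subsetI)
    fix z :: complex
    \<comment> \<open>the coordinates of \<open>z\<close> with respect to the basis \<open>\<tau>\<close>, \<open>1\<close>\<close>
    define s where "s = Im z / Im \<tau>"
    define t where "t = Re z - s * Re \<tau>"
    define w where "w = of_real (frac s) * \<tau> + of_real (frac t)"
    have "z = of_real s * \<tau> + of_real t"
      using \<tau> by (simp add: complex_eq_iff s_def t_def)
    then have "z = w + of_int \<lfloor>s\<rfloor> * \<tau> + of_int \<lfloor>t\<rfloor>"
      by (simp add: w_def frac_def algebra_simps)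
    moreover have "w \<in> P"
      unfolding w_def P_def by (auto intro!: image_eqI[where x = "(frac s, frac t)"]
          simp: less_imp_le[OF frac_lt_1])
    ultimately show "f z \<in> f ` P" using per[of w] by auto
  qed
  ultimately show ?thesis by (rule bounded_subset)
qed

text \<open>
  The quotient of the two functions is doubly periodic. Its only possible singularities are lattice
  points, hence translates of \<open>0\<close>, and there it extends with value \<open>1\<close>, because both functions
  vanish at \<open>0\<close> with the same nonzero derivative. So it is entire and bounded, and Liouville's
  theorem applies.
\<close>

lemma theta_quasi_periodic_unique:
  assumes \<tau>: "Im \<tau> > 0" and F: "F holomorphic_on UNIV" and qp: "theta_quasi_periodic \<tau> F"
    and F0: "F 0 = 0"
    and F': "(F has_field_derivative - (2 * of_real pi * \<i>)) (at 0)"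
  shows "F z = klein_sigma z \<tau>"
proof -
  define G where "G z = klein_sigma z \<tau>" for z
  define E where "E z = (if G z = 0 then 1 else F z / G z)" for z
  note G = holomorphic_klein_sigma[OF \<tau>, of UNIV, folded G_def]
  note G' = DERIV_klein_sigma_0[OF \<tau>, folded G_def]
  note G0 = klein_sigma_0[OF \<tau>, folded G_def]
  note Gz = klein_sigma_eq_0D[OF \<tau>, folded G_def]
  note Flat = theta_quasi_periodic_plus_lattice[OF qp]
  note Glat = klein_sigma_plus_lattice[OF \<tau>, folded G_def]
  have per: "E (z + of_int m * \<tau> + of_int n) = E z" for z m n
    by (simp add: E_def Flat Glat)
  have diff_0: "E field_differentiable at 0"
  proof -
    define D where "D = - (2 * of_real pi * \<i>)"
    \<comment> \<open>the quotients by \<open>z\<close>, with the singularity at \<open>0\<close> removed\<close>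
    define F1 where "F1 z = (if z = 0 then D else F z / z)" for z
    define G1 where "G1 z = (if z = 0 then D else G z / z)" for z
    have F1: "F1 holomorphic_on UNIV"
      using F by (rule pole_theorem_open_0[where a = 0])
        (use F0 DERIV_imp_deriv[OF F'] in \<open>auto simp: F1_def D_def\<close>)
    have G1: "G1 holomorphic_on UNIV"
      using G by (rule pole_theorem_open_0[where a = 0])
        (use G0 DERIV_imp_deriv[OF G'] in \<open>auto simp: G1_def D_def\<close>)
    define U where "U = G1 -` (- {0})"
    have U: "open U"
      unfolding U_def using continuous_open_vimage[of "- {0}" G1] G1
      by (auto simp: continuous_on_eq_continuous_at intro!: open_vimage holomorphic_on_imp_continuous_on)
    have "0 \<in> U" by (simp add: U_def G1_def D_def)
    have "(\<lambda>z. F1 z / G1 z) holomorphic_on U"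
      by (intro holomorphic_on_divide holomorphic_on_subset[OF F1] holomorphic_on_subset[OF G1])
        (auto simp: U_def)
    then have "E holomorphic_on U"
      by (rule holomorphic_transform)
        (auto simp: U_def E_def F1_def G1_def G0 split: if_splits)
    with U \<open>0 \<in> U\<close> show ?thesis by (simp add: holomorphic_on_open field_differentiable_def)
  qed
  have "E field_differentiable at z" for z
  proof (cases "G z = 0")
    case True
    then obtain m n where z: "z = of_int m * \<tau> + of_int n" using Gz[of z] by metis
    have "E w = E (w - z)" for w
      using per[of "w - z" m n] by (simp add: z add_ac)
    then have "E = E \<circ> (\<lambda>w. w - z)" by (auto simp: fun_eq_iff)
    moreover have "(E \<circ> (\<lambda>w. w - z)) field_differentiable at z"
      by (rule field_differentiable_compose) (use diff_0 in \<open>auto intro!: derivative_intros\<close>)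
    ultimately show ?thesis by simp
  next
    case False
    define U where "U = G -` (- {0})"
    have U: "open U"
      unfolding U_def using G by (intro open_vimage holomorphic_on_imp_continuous_on) auto
    have "(\<lambda>z. F z / G z) holomorphic_on U"
      by (intro holomorphic_on_divide holomorphic_on_subset[OF F] holomorphic_on_subset[OF G])
        (auto simp: U_def)
    then have "E holomorphic_on U"
      by (rule holomorphic_transform) (auto simp: U_def E_def)
    with U False show ?thesis
      by (auto simp: holomorphic_on_open field_differentiable_def U_def)
  qed
  then have E: "E holomorphic_on UNIV"
    by (simp add: holomorphic_on_def)
  then have "bounded (range E)"
    by (intro bounded_range_lattice_periodic[OF \<tau>] per holomorphic_on_imp_continuous_on)
  with E have "E constant_on UNIV" by (rule Liouville_theorem)
  then have "E z = E 0" by (auto simp: constant_on_def)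
  then have E1: "E z = 1" by (simp add: E_def G0)
  show ?thesis
  proof (cases "G z = 0")
    case True
    then obtain m n where "z = 0 + of_int m * \<tau> + of_int n" using Gz[of z] by auto
    then have "F z = 0" using Flat[of 0 m n] F0 by simp
    then show ?thesis using True by (simp add: G_def)
  next
    case False
    then show ?thesis using E1 by (simp add: E_def G_def)
  qed
qed

lemma mobius_denominator_nonzero:
  fixes a b c d :: int
  assumes "a * d - b * c = 1" and "Im \<tau> > 0"
  shows "of_int c * \<tau> + of_int d \<noteq> 0"
proof
  assume *: "of_int c * \<tau> + of_int d = 0"
  then have "of_int c * Im \<tau> = 0" by (auto simp: complex_eq_iff)
  with assms have "c = 0" by simp
  with * assms show False by simp
qed

lemma Im_mobius_pos:
  fixes a b c d :: int
  assumes det: "a * d - b * c = 1" and \<tau>: "Im \<tau> > 0"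
  shows "Im ((of_int a * \<tau> + of_int b) / (of_int c * \<tau> + of_int d)) > 0"
proof -
  define j where "j = of_int c * \<tau> + of_int d"
  have j: "j \<noteq> 0" using mobius_denominator_nonzero[OF assms] by (simp add: j_def)
  have "Im ((of_int a * \<tau> + of_int b) * cnj j) = of_int (a * d - b * c) * Im \<tau>"
    by (simp add: j_def algebra_simps)
  then have "Im ((of_int a * \<tau> + of_int b) / j) = Im \<tau> / (cmod j)\<^sup>2"
    by (simp add: det complex_div_cnj[of _ j] flip: of_real_power)
  with \<tau> j show ?thesis by (simp add: j_def)
qed

text \<open>
  As functions of \<open>z\<close>, both sides have the same multipliers. The periods \<open>1\<close> and \<open>\<tau>\<close> become, after
  division by \<open>j\<close>, the lattice vectors \<open>a - c * \<sigma>\<close> and \<open>d * \<sigma> - b\<close> of the transformed point \<open>\<sigma>\<close>, and the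
  Gaussian factor repairs the resulting exponential. The derivatives at \<open>0\<close> agree because the factor
  \<open>j\<close> cancels the inner derivative of \<open>z / j\<close>. Hence the law holds for every matrix at once, without
  generators of the modular group.
\<close>

theorem klein_sigma_mobius:
  fixes a b c d :: int
  assumes det: "a * d - b * c = 1" and \<tau>: "Im \<tau> > 0"
  defines "j \<equiv> of_int c * \<tau> + of_int d"
  shows "j * e (- (of_int c * z ^ 2 / (2 * j))) * klein_sigma (z / j) ((of_int a * \<tau> + of_int b) / j)
           = klein_sigma z \<tau>"
proof -
  define \<sigma> where "\<sigma> = (of_int a * \<tau> + of_int b) / j"
  have j: "j \<noteq> 0" and \<sigma>: "Im \<sigma> > 0"
    using mobius_denominator_nonzero[OF det \<tau>] Im_mobius_pos[OF det \<tau>]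
    by (simp_all add: j_def \<sigma>_def)
  have det': "of_int a * of_int d - of_int b * of_int c = (1 :: complex)"
    using arg_cong[OF det, of "of_int :: int \<Rightarrow> complex"] by simp
  have \<sigma>j: "\<sigma> * j = of_int a * \<tau> + of_int b" using j by (simp add: \<sigma>_def)
  have one: "1 / j = of_int a - of_int c * \<sigma>"
  proof -
    have "(of_int a - of_int c * \<sigma>) * j = of_int a * j - of_int c * (\<sigma> * j)"
      by (simp add: algebra_simps)
    also have "\<dots> = of_int a * of_int d - of_int b * of_int c"
      unfolding \<sigma>j by (simp add: j_def algebra_simps)
    finally show ?thesis using j det' by (simp add: field_simps)
  qed
  have tau: "\<tau> / j = of_int d * \<sigma> - of_int b"
  proof -
    have "(of_int d * \<sigma> - of_int b) * j = of_int d * (\<sigma> * j) - of_int b * j"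
      by (simp add: algebra_simps)
    also have "\<dots> = (of_int a * of_int d - of_int b * of_int c) * \<tau>"
      unfolding \<sigma>j by (simp add: j_def algebra_simps)
    finally show ?thesis using j det' by (simp add: field_simps)
  qed
  define F where "F z = j * e (- (of_int c * z ^ 2 / (2 * j))) * klein_sigma (z / j) \<sigma>" for z
  note lat = klein_sigma_plus_lattice[OF \<sigma>]
  \<comment> \<open>the following two parities give both multipliers of \<open>F\<close> the sign \<open>- 1 = e (1 / 2)\<close>\<close>
  have odd_det: "odd (a * d - b * c)" using det by simp
  then have "even ((a + 1) * (c + 1))" by auto
  then obtain k where k: "(a + 1) * (c + 1) = 2 * k" by (elim evenE)
  have "even ((b + 1) * (d + 1))" using odd_det by auto
  then obtain l where l: "(b + 1) * (d + 1) = 2 * l" by (elim evenE)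
  have "F z = klein_sigma z \<tau>"
  proof (rule theta_quasi_periodic_unique[OF \<tau>])
    have "(\<lambda>z. klein_sigma (z / j) \<sigma>) holomorphic_on UNIV"
      by (rule holomorphic_on_compose_gen[where g = "\<lambda>z. klein_sigma z \<sigma>" and t = UNIV, unfolded o_def])
        (use j in \<open>auto intro!: holomorphic_intros holomorphic_klein_sigma[OF \<sigma>]\<close>)
    then show "F holomorphic_on UNIV"
      unfolding F_def using j by (intro holomorphic_intros) auto
    show F0: "F 0 = 0" by (simp add: F_def klein_sigma_0[OF \<sigma>])
    have "((\<lambda>z. klein_sigma (z / j) \<sigma>) has_field_derivative - (2 * of_real pi * \<i>) * (1 / j)) (at 0)"
      by (rule DERIV_chain2[where f = "\<lambda>z. klein_sigma z \<sigma>"])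
        (use j DERIV_klein_sigma_0[OF \<sigma>] in \<open>auto intro!: derivative_eq_intros\<close>)
    moreover have "((\<lambda>z. j * e (- (of_int c * z ^ 2 / (2 * j)))) has_field_derivative
       deriv (\<lambda>z. j * e (- (of_int c * z ^ 2 / (2 * j)))) 0) (at 0)"
      using j by (intro holomorphic_derivI[where S = UNIV] holomorphic_intros) auto
    ultimately have "(F has_field_derivative
          deriv (\<lambda>z. j * e (- (of_int c * z ^ 2 / (2 * j)))) 0 * klein_sigma (0 / j) \<sigma> +
            (- (2 * of_real pi * \<i>) * (1 / j)) * (j * e (- (of_int c * 0 ^ 2 / (2 * j))))) (at 0)"
      unfolding F_def by (intro DERIV_mult)
    then show "(F has_field_derivative - (2 * of_real pi * \<i>)) (at 0)"
      using j by (simp add: klein_sigma_0[OF \<sigma>])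
    show "theta_quasi_periodic \<tau> F"
      unfolding theta_quasi_periodic_def
    proof safe
      fix z
      have "(z + 1) / j = z / j + of_int (- c) * \<sigma> + of_int a"
        using one by (simp add: add_divide_distrib)
      then have "F (z + 1) = j * (e (- (of_int c * (z + 1) ^ 2 / (2 * j))) *
         e ((of_int (- c) + of_int a) / 2 - of_int (- c) ^ 2 * \<sigma> / 2 - of_int (- c) * (z / j))) *
         klein_sigma (z / j) \<sigma>"
        by (simp only: F_def lat mult.assoc)
      also have "e (- (of_int c * (z + 1) ^ 2 / (2 * j))) *
         e ((of_int (- c) + of_int a) / 2 - of_int (- c) ^ 2 * \<sigma> / 2 - of_int (- c) * (z / j)) =
         e (1 / 2) * e (- (of_int c * z ^ 2 / (2 * j))) * e (of_int (k - a * c - c - 1))"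
        unfolding e_add[symmetric]
      proof (rule arg_cong[where f = e])
        define u where "u = 1 / j"
        have k': "of_int k = (of_int a + 1) * (of_int c + 1 :: complex) / 2"
          using arg_cong[OF k, of "of_int :: int \<Rightarrow> complex"] by simp
        have "of_int c * \<sigma> = of_int a - u" using one by (simp add: u_def)
        then have s: "of_int c ^ 2 * \<sigma> = (of_int a - u) * of_int c"
          by (simp add: power2_eq_square)
        have w: "of_int c * w / (2 * j) = of_int c * w * u / 2" "w / j = w * u" for w
          by (simp_all add: u_def)
        show "- (of_int c * (z + 1) ^ 2 / (2 * j)) +
           ((of_int (- c) + of_int a) / 2 - of_int (- c) ^ 2 * \<sigma> / 2 - of_int (- c) * (z / j)) =
           1 / 2 + - (of_int c * z ^ 2 / (2 * j)) + of_int (k - a * c - c - 1)"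
          by (simp only: of_int_minus of_int_diff of_int_mult of_int_1 power2_minus s w k')
            (simp add: field_simps power2_eq_square)
      qed
      finally show "F (z + 1) = e (1 / 2) * F z"
        by (simp only: F_def e_of_int mult_1_left mult_1_right mult_ac)
    next
      fix z
      have "(z + \<tau>) / j = z / j + of_int d * \<sigma> + of_int (- b)"
        using tau by (simp add: add_divide_distrib)
      then have "F (z + \<tau>) = j * (e (- (of_int c * (z + \<tau>) ^ 2 / (2 * j))) *
         e ((of_int d + of_int (- b)) / 2 - of_int d ^ 2 * \<sigma> / 2 - of_int d * (z / j))) *
         klein_sigma (z / j) \<sigma>"
        by (simp only: F_def lat mult.assoc)
      also have "e (- (of_int c * (z + \<tau>) ^ 2 / (2 * j))) *
         e ((of_int d + of_int (- b)) / 2 - of_int d ^ 2 * \<sigma> / 2 - of_int d * (z / j)) =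
         e (1 / 2 - \<tau> / 2 - z) * (e (- (of_int c * z ^ 2 / (2 * j))) * e (of_int (l - b * d - b - 1)))"
        unfolding e_add[symmetric]
      proof (rule arg_cong[where f = e])
        define u where "u = 1 / j"
        have l': "of_int l = (of_int b + 1) * (of_int d + 1 :: complex) / 2"
          using arg_cong[OF l, of "of_int :: int \<Rightarrow> complex"] by simp
        have "u * j = 1" using j by (simp add: u_def)
        then have du: "of_int d * u = 1 - of_int c * \<tau> * u"
          by (simp add: j_def algebra_simps)
        have "of_int d * \<sigma> = \<tau> * u + of_int b" using tau by (simp add: u_def)
        then have "of_int d ^ 2 * \<sigma> = (of_int d * u) * \<tau> + of_int d * of_int b"
          by (simp add: power2_eq_square mult.assoc) (simp add: algebra_simps)
        then have s: "of_int d ^ 2 * \<sigma> = (1 - of_int c * \<tau> * u) * \<tau> + of_int d * of_int b"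
          by (simp only: du)
        have w: "of_int c * w / (2 * j) = of_int c * w * u / 2" for w
          by (simp add: u_def)
        have z: "of_int d * (z / j) = (1 - of_int c * \<tau> * u) * z"
          unfolding du[symmetric] by (simp add: u_def)
        show "- (of_int c * (z + \<tau>) ^ 2 / (2 * j)) +
           ((of_int d + of_int (- b)) / 2 - of_int d ^ 2 * \<sigma> / 2 - of_int d * (z / j)) =
           1 / 2 - \<tau> / 2 - z + (- (of_int c * z ^ 2 / (2 * j)) + of_int (l - b * d - b - 1))"
          by (simp only: of_int_minus of_int_diff of_int_mult of_int_1 s w z l')
            (simp add: field_simps power2_eq_square)
      qed
      finally show "F (z + \<tau>) = e (1 / 2 - \<tau> / 2 - z) * F z"
        by (simp only: F_def e_of_int mult_1_left mult_1_right mult_ac)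
    qed
  qed
  then show ?thesis by (simp add: F_def \<sigma>_def)
qed

section \<open>Klein forms\<close>

lemma qpow_conv_e: "qpow \<tau> s = e (of_rat s * \<tau>)"
  by (simp add: qpow_def e_def mult_ac)

text \<open>
  The exponential prefactors of the Klein form multiply to \<open>e ((r1 - 1) * z / 2)\<close>, and \<open>klein_sigma\<close>
  already contains \<open>e (- z / 2)\<close>.
\<close>

lemma klein_form_conv_klein_sigma:
  fixes r1 r2 :: rat
  assumes \<tau>: "Im \<tau> > 0"
  defines "z \<equiv> of_rat r1 * \<tau> + of_rat r2"
  shows "klein_form r1 r2 \<tau> = e (of_rat r1 * z / 2) * klein_sigma z \<tau>"
proof -
  note q = norm_e_less_1[OF \<tau>]
  note conv = convergent_prod_qpoch[OF q]
  have "(\<Prod>n. (1 - e \<tau> ^ Suc n * e z) * (1 - e \<tau> ^ Suc n * inverse (e z)) * (1 - e \<tau> ^ Suc n) powi (-2)) =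
        (\<Prod>n. (1 - e (z + \<tau>) * e \<tau> ^ n) * (1 - e (\<tau> - z) * e \<tau> ^ n) * inverse ((1 - e \<tau> * e \<tau> ^ n) ^ 2))"
    by (intro prodinf_cong) (simp add: e_add e_diff field_simps power_int_minus)
  also have "\<dots> = qpoch (e (z + \<tau>)) (e \<tau>) * qpoch (e (\<tau> - z)) (e \<tau>) / qpoch (e \<tau>) (e \<tau>) ^ 2"
    unfolding qpoch_def divide_inverse
    by (simp only: prodinf_mult[OF conv conv]
        prodinf_mult[OF convergent_prod_mult[OF conv conv] convergent_prod_inverse[OF convergent_prod_power[OF conv]]]
        prodinf_power[OF conv, symmetric] prodinf_inverse[OF convergent_prod_power[OF conv], symmetric])
  finally have prod: "(\<Prod>n. (1 - e \<tau> ^ Suc n * e z) * (1 - e \<tau> ^ Suc n * inverse (e z)) * (1 - e \<tau> ^ Suc n) powi (-2))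
      = qpoch (e (z + \<tau>)) (e \<tau>) * qpoch (e (\<tau> - z)) (e \<tau>) / qpoch (e \<tau>) (e \<tau>) ^ 2" .
  have "klein_form r1 r2 \<tau> = exp (of_real pi * \<i> * of_rat (r2 * (r1 - 1))) *
      e (of_rat (r1 * (r1 - 1) / 2) * \<tau>) * (1 - e z) *
      (\<Prod>n. (1 - e \<tau> ^ Suc n * e z) * (1 - e \<tau> ^ Suc n * inverse (e z)) * (1 - e \<tau> ^ Suc n) powi (-2))"
    unfolding klein_form_def Let_def qpow_conv_e of_rat_1 mult_1_left z_def[symmetric] e_def[symmetric] ..
  also have "exp (of_real pi * \<i> * of_rat (r2 * (r1 - 1))) = e (of_rat (r2 * (r1 - 1)) / 2)"
    by (simp add: e_def mult.assoc)
  also have "e (of_rat (r2 * (r1 - 1)) / 2) * e (of_rat (r1 * (r1 - 1) / 2) * \<tau>) =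
               e (of_rat r1 * z / 2) * e (- z / 2)"
    unfolding e_add[symmetric]
    by (rule arg_cong[where f = e])
      (simp add: z_def of_rat_mult of_rat_diff of_rat_divide field_simps)
  finally show ?thesis
    using qpoch_step[OF q, of "e z"] unfolding prod by (simp add: klein_sigma_def e_add)
qed

text \<open>
  The Gaussian factor of the transformation law of \<open>klein_sigma\<close> is absorbed by the factor
  \<open>e (r1 * z / 2)\<close>, so that the Klein forms are permuted, by the right action of the matrix on the row
  vector \<open>(r1, r2)\<close>, up to the automorphy factor of weight \<open>- 1\<close>.
\<close>

lemma klein_form_mobius:
  fixes a b c d :: int and r1 r2 :: rat
  assumes det: "a * d - b * c = 1" and \<tau>: "Im \<tau> > 0"
  defines "j \<equiv> of_int c * \<tau> + of_int d"
  shows "klein_form r1 r2 ((of_int a * \<tau> + of_int b) / j) =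
           klein_form (r1 * of_int a + r2 * of_int c) (r1 * of_int b + r2 * of_int d) \<tau> / j"
proof -
  define R1 where "R1 = r1 * of_int a + r2 * of_int c"
  define R2 where "R2 = r1 * of_int b + r2 * of_int d"
  define \<sigma> where "\<sigma> = (of_int a * \<tau> + of_int b) / j"
  define Z :: complex where "Z = of_rat R1 * \<tau> + of_rat R2"
  have j: "j \<noteq> 0" and \<sigma>: "Im \<sigma> > 0"
    using mobius_denominator_nonzero[OF det \<tau>] Im_mobius_pos[OF det \<tau>]
    by (simp_all add: j_def \<sigma>_def)
  have "(of_rat r1 * \<sigma> + of_rat r2) * j = of_rat r1 * (\<sigma> * j) + of_rat r2 * j"
    by (simp add: algebra_simps)
  also have "\<dots> = Z"
    using j by (simp add: \<sigma>_def) (simp add: j_def Z_def R1_def R2_def of_rat_add of_rat_mult algebra_simps)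
  finally have z: "of_rat r1 * \<sigma> + of_rat r2 = Z / j" using j by (simp add: field_simps)
  have det': "of_int a * of_int d - of_int b * of_int c = (1 :: rat)"
    using arg_cong[OF det, of "of_int :: int \<Rightarrow> rat"] by simp
  have "R1 * of_int d - R2 * of_int c = r1 * (of_int a * of_int d - of_int b * of_int c)"
    by (simp add: R1_def R2_def algebra_simps)
  then have "of_rat r1 = (of_rat (R1 * of_int d - R2 * of_int c) :: complex)"
    by (simp only: det') simp
  then have "of_rat r1 + of_int c * Z = of_rat R1 * j"
    by (simp add: Z_def j_def of_rat_diff of_rat_mult algebra_simps)
  then have "of_rat R1 * Z / 2 = (of_rat r1 + of_int c * Z) / j * Z / 2" using j by simp
  then have expo: "of_rat R1 * Z / 2 = of_rat r1 * (Z / j) / 2 + of_int c * Z ^ 2 / (2 * j)"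
    using j by (simp add: field_simps power2_eq_square)
  have "klein_form r1 r2 \<sigma> = e (of_rat r1 * (Z / j) / 2) * klein_sigma (Z / j) \<sigma>"
    unfolding klein_form_conv_klein_sigma[OF \<sigma>] z ..
  also have "klein_sigma (Z / j) \<sigma> = e (of_int c * Z ^ 2 / (2 * j)) * klein_sigma Z \<tau> / j"
    using klein_sigma_mobius[OF det \<tau>, folded j_def, of Z, symmetric] j by (simp add: e_minus \<sigma>_def)
  also have "e (of_rat r1 * (Z / j) / 2) * (e (of_int c * Z ^ 2 / (2 * j)) * klein_sigma Z \<tau> / j) =
               e (of_rat R1 * Z / 2) * klein_sigma Z \<tau> / j"
    unfolding expo e_add by simp
  also have "e (of_rat R1 * Z / 2) * klein_sigma Z \<tau> = klein_form R1 R2 \<tau>"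
    by (simp add: klein_form_conv_klein_sigma[OF \<tau>] Z_def)
  finally show ?thesis by (simp add: \<sigma>_def R1_def R2_def)
qed

lemma klein_form_translate:
  fixes m n :: int and r1 r2 :: rat
  assumes \<tau>: "Im \<tau> > 0"
  shows "klein_form (r1 + of_int m) (r2 + of_int n) \<tau> =
    e (of_rat (r1 * of_int n - r2 * of_int m + of_int (m * n + m + n)) / 2) * klein_form r1 r2 \<tau>"
proof -
  define z :: complex where "z = of_rat r1 * \<tau> + of_rat r2"
  have z': "of_rat (r1 + of_int m) * \<tau> + of_rat (r2 + of_int n) = z + of_int m * \<tau> + of_int n"
    by (simp add: z_def of_rat_add algebra_simps)
  have "klein_form (r1 + of_int m) (r2 + of_int n) \<tau> =
     e (of_rat (r1 + of_int m) * (z + of_int m * \<tau> + of_int n) / 2) *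
     e ((of_int m + of_int n) / 2 - of_int m ^ 2 * \<tau> / 2 - of_int m * z) * klein_sigma z \<tau>"
    unfolding klein_form_conv_klein_sigma[OF \<tau>] z' klein_sigma_plus_lattice[OF \<tau>] by (simp only: mult.assoc)
  also have "e (of_rat (r1 + of_int m) * (z + of_int m * \<tau> + of_int n) / 2) *
     e ((of_int m + of_int n) / 2 - of_int m ^ 2 * \<tau> / 2 - of_int m * z) =
     e (of_rat (r1 * of_int n - r2 * of_int m + of_int (m * n + m + n)) / 2) * e (of_rat r1 * z / 2)"
    unfolding e_add[symmetric]
    by (rule arg_cong[where f = e])
      (simp add: z_def of_rat_add of_rat_diff of_rat_mult field_simps power2_eq_square)
  finally show ?thesis by (simp add: klein_form_conv_klein_sigma[OF \<tau>] z_def)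
qed

section \<open>Holomorphy at the cusps\<close>

text \<open>
  For \<open>0 \<le> r1 < 1\<close> the leading exponent \<open>r1 * (r1 - 1) / 2\<close> of the Klein form in \<open>q\<close> is at most \<open>0\<close>, so
  the reciprocal has no pole at the cusp. With \<open>r1 = u / N\<close> all exponents of \<open>q\<close> in the
  product lie in \<open>\<int> / (2 * N\<^sup>2)\<close>, so the reciprocal is a function of \<open>w = e (\<tau> / (2 * N\<^sup>2))\<close>. It is
  holomorphic on the disc because the denominator has no zero there: its factors have the form
  \<open>1 - \<xi> * w ^ k\<close> with \<open>norm \<xi> = 1\<close>, and \<open>k = 0\<close> occurs only for \<open>u = 0\<close>, where the factor is
  \<open>1 - e r\<close> with nonintegral \<open>r\<close>.
\<close>

lemma inverse_klein_form_q_holomorphic_aux: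
  fixes N u :: nat and r :: rat
  assumes "u < N" and nonint: "u = 0 \<Longrightarrow> r \<notin> \<int>"
  obtains H where "H holomorphic_on ball 0 1"
    "\<And>\<tau>. Im \<tau> > 0 \<Longrightarrow>
       inverse (klein_form (of_nat u / of_nat N) r \<tau>) = H (e (\<tau> / of_nat (2 * N ^ 2)))"
proof -
  define \<rho> :: complex where "\<rho> = of_nat u / of_nat N"
  define \<zeta> where "\<zeta> = e (of_rat r)"
  define p :: "complex \<Rightarrow> complex" where "p w = w ^ (2 * N ^ 2)" for w
  define H where "H w = e ((1 - \<rho>) * of_rat r / 2) * w ^ (u * (N - u)) * qpoch (p w) (p w) ^ 2 /
      (qpoch (\<zeta> * w ^ (2 * N * u)) (p w) * qpoch (inverse \<zeta> * w ^ (2 * N * (N - u))) (p w))" for w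
  have N: "N > 0" using assms by simp
  have p: "norm (p w) < 1" if "w \<in> ball 0 1" for w
    using that N by (simp add: p_def norm_power power_less_one_iff)
  have norm_\<zeta>: "norm \<zeta> = 1"
  proof -
    have "(of_rat r :: complex) \<in> \<real>"
      by (cases r) (simp add: of_rat_rat)
    then show ?thesis by (simp add: \<zeta>_def norm_e complex_is_Real_iff)
  qed
  have power_less: "norm (\<xi> * w ^ k) < 1" if "norm \<xi> = 1" "w \<in> ball 0 1" "k > 0" for w \<xi> :: complex and k
    using that by (simp add: norm_mult norm_power power_less_one_iff)
  have nz1: "qpoch (\<zeta> * w ^ (2 * N * u)) (p w) \<noteq> 0" if w: "w \<in> ball 0 1" for w
  proof
    assume "qpoch (\<zeta> * w ^ (2 * N * u)) (p w) = 0"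
    then obtain k where "\<zeta> * w ^ (2 * N * u) * p w ^ k = 1"
      using qpoch_eq_0_iff[OF p[OF w]] by auto
    then have *: "\<zeta> * w ^ (2 * N * u + 2 * N ^ 2 * k) = 1"
      by (simp add: p_def power_add power_mult mult.assoc)
    then have "2 * N * u + 2 * N ^ 2 * k = 0"
      using power_less[OF norm_\<zeta> w] by (metis gr0I norm_one order_less_irrefl)
    with * N have "u = 0" "\<zeta> = 1" by simp_all
    then obtain i where "(of_rat r :: complex) = of_int i"
      by (auto simp: \<zeta>_def e_eq_1_iff elim: Ints_cases)
    then have "r = of_int i" by (metis of_rat_eq_iff of_rat_of_int_eq)
    with nonint \<open>u = 0\<close> show False by simp
  qed
  have nz2: "qpoch (inverse \<zeta> * w ^ (2 * N * (N - u))) (p w) \<noteq> 0" if w: "w \<in> ball 0 1" for w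
  proof
    assume "qpoch (inverse \<zeta> * w ^ (2 * N * (N - u))) (p w) = 0"
    then obtain k where "inverse \<zeta> * w ^ (2 * N * (N - u)) * p w ^ k = 1"
      using qpoch_eq_0_iff[OF p[OF w]] by auto
    then have "inverse \<zeta> * w ^ (2 * N * (N - u) + 2 * N ^ 2 * k) = 1"
      by (simp add: p_def power_add power_mult mult.assoc)
    moreover have "2 * N * (N - u) + 2 * N ^ 2 * k > 0" using assms by simp
    moreover have "norm (inverse \<zeta>) = 1" using norm_\<zeta> by (simp add: norm_inverse)
    ultimately show False using power_less[OF _ w] by (metis norm_one order_less_irrefl)
  qed
  show thesis
  proof (rule that)
    have hp: "p holomorphic_on ball 0 1" unfolding p_def by (intro holomorphic_intros)
    show "H holomorphic_on ball 0 1"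
      unfolding H_def using nz1 nz2 p
      by (intro holomorphic_intros holomorphic_qpoch hp) auto
    fix \<tau> :: complex assume \<tau>: "Im \<tau> > 0"
    define w where "w = e (\<tau> / of_nat (2 * N ^ 2))"
    define z where "z = \<rho> * \<tau> + of_rat r"
    have w_power: "w ^ k = e (of_nat k * \<tau> / of_nat (2 * N ^ 2))" for k
      by (simp add: w_def e_power)
    have 1: "p w = e \<tau>"
      using N by (simp add: p_def w_power)
    have 2: "\<zeta> * w ^ (2 * N * u) = e z"
      unfolding \<zeta>_def w_power e_add[symmetric]
      by (rule arg_cong[where f = e]) (use N in \<open>simp add: z_def \<rho>_def field_simps power2_eq_square\<close>)
    have 3: "inverse \<zeta> * w ^ (2 * N * (N - u)) = e (\<tau> - z)"
      unfolding \<zeta>_def w_power e_add[symmetric] e_minus[symmetric]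
      by (rule arg_cong[where f = e])
        (use assms in \<open>simp add: z_def \<rho>_def of_nat_diff field_simps power2_eq_square\<close>)
    have 4: "e ((1 - \<rho>) * of_rat r / 2) * w ^ (u * (N - u)) = inverse (e (\<rho> * z / 2) * e (- z / 2))"
      unfolding w_power e_add[symmetric] e_minus[symmetric]
      by (rule arg_cong[where f = e])
        (use assms in \<open>simp add: z_def \<rho>_def of_nat_diff field_simps power2_eq_square\<close>)
    have "klein_form (of_nat u / of_nat N) r \<tau> = e (\<rho> * z / 2) * klein_sigma z \<tau>"
      using klein_form_conv_klein_sigma[OF \<tau>, of "of_nat u / of_nat N" r]
      by (simp add: z_def \<rho>_def of_rat_divide)
    then have "inverse (klein_form (of_nat u / of_nat N) r \<tau>) = H w"
      unfolding H_def 1 2 3 4 klein_sigma_def by (simp add: field_simps)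
    then show "inverse (klein_form (of_nat u / of_nat N) r \<tau>) = H (e (\<tau> / of_nat (2 * N ^ 2)))"
      by (simp add: w_def)
  qed
qed

text \<open>
  Translating the first index by an integer changes the Klein form only by a constant, which reduces
  the claim to the range \<open>0 \<le> r1 < 1\<close>.
\<close>

lemma inverse_klein_form_q_holomorphic:
  fixes u N :: int and r :: rat
  assumes N: "N > 0" and nonint: "\<not> (N dvd u \<and> r \<in> \<int>)"
  obtains H where "H holomorphic_on ball 0 1"
    "\<And>\<tau>. Im \<tau> > 0 \<Longrightarrow>
       inverse (klein_form (of_int u / of_int N) r \<tau>) = H (e (\<tau> / of_int (2 * N ^ 2)))"
proof -
  define v where "v = nat (u mod N)"
  \<comment> \<open>natural numbers, to be used as exponents\<close>
  define M where "M = nat N"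
  have v: "int v = u mod N" "v < M" and M: "int M = N"
    using N by (simp_all add: v_def M_def)
  have "of_int u = (of_int (N * (u div N) + u mod N) :: rat)" by simp
  also have "\<dots> = of_int N * of_int (u div N) + of_nat v" by (simp flip: v(1))
  finally have u: "of_int u / of_int N = of_nat v / of_nat M + (of_int (u div N) :: rat)"
    using N by (simp add: field_simps flip: M)
  obtain H where H: "H holomorphic_on ball 0 1"
    "\<And>\<tau>. Im \<tau> > 0 \<Longrightarrow>
       inverse (klein_form (of_nat v / of_nat M) r \<tau>) = H (e (\<tau> / of_nat (2 * M ^ 2)))"
    using inverse_klein_form_q_holomorphic_aux[OF v(2), of r] nonint v(1)
    by (metis dvd_eq_mod_eq_0 of_nat_0)
  define C where "C = inverse (e (of_rat (- r * of_int (u div N) + of_int (u div N)) / 2))"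
  show thesis
  proof (rule that[of "\<lambda>w. C * H w"])
    show "(\<lambda>w. C * H w) holomorphic_on ball 0 1" by (intro holomorphic_intros H)
    fix \<tau> :: complex assume \<tau>: "Im \<tau> > 0"
    have h: "of_int (2 * N ^ 2) = (of_nat (2 * M ^ 2) :: complex)" by (simp flip: M)
    show "inverse (klein_form (of_int u / of_int N) r \<tau>) = C * H (e (\<tau> / of_int (2 * N ^ 2)))"
      using klein_form_translate[OF \<tau>, of "of_nat v / of_nat M" "u div N" r 0]
      unfolding u h H(2)[OF \<tau>, symmetric] C_def by simp
  qed
qed

lemma has_q_expansion_if_q_holomorphic:
  assumes H: "H holomorphic_on ball 0 1" and h: "h > 0"
    and g: "\<And>\<tau>. Im \<tau> > 0 \<Longrightarrow> g \<tau> = H (e (\<tau> / of_nat h))"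
  shows "has_q_expansion g"
  unfolding has_q_expansion_def
proof (intro exI conjI ballI)
  show "h > 0" by (rule h)
  fix \<tau> assume "\<tau> \<in> upper_half_plane"
  then have \<tau>: "Im \<tau> > 0" by (simp add: upper_half_plane_def)
  then have "e (\<tau> / of_nat h) \<in> ball 0 1"
    using h norm_e_less_1[of "\<tau> / of_nat h"] by (simp add: zero_less_divide_iff)
  from holomorphic_power_series[OF H this]
  show "(\<lambda>n. (deriv ^^ n) H 0 / fact n * qpow \<tau> (of_nat n / of_nat h)) sums g \<tau>"
    by (simp add: g \<tau> qpow_conv_e e_power of_rat_divide)
qed

section \<open>The product over the division points of order N\<close>

lemma SL2Z_det:
  "A \<in> SL2Z \<Longrightarrow> A $ 1 $ 1 * A $ 2 $ 2 - A $ 1 $ 2 * A $ 2 $ 1 = 1"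
  by (simp add: SL2Z_def det_2)

text \<open>
  There are \<open>N - 1\<close> factors, each of weight \<open>M\<close>, so the automorphy factors cancel
  exactly.
\<close>

lemma slash_prod_klein_form:
  fixes N M :: int and A :: "int ^ 2 ^ 2"
  assumes A: "A \<in> SL2Z" and N: "N \<ge> 1" and \<tau>: "Im \<tau> > 0"
  shows "slash (\<lambda>\<tau>. \<Prod>n=1..N-1. klein_form 0 (of_int n / of_int N) \<tau> powi (- M)) A (M * (N - 1)) \<tau> =
    (\<Prod>n=1..N-1. klein_form (of_int (n * A $ 2 $ 1) / of_int N) (of_int (n * A $ 2 $ 2) / of_int N) \<tau> powi (- M))"
proof -
  define a b c d where abcd: "a = A $ 1 $ 1" "b = A $ 1 $ 2" "c = A $ 2 $ 1" "d = A $ 2 $ 2"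
  define j where "j = of_int c * \<tau> + of_int d"
  have det: "a * d - b * c = 1" using SL2Z_det[OF A] by (simp add: abcd)
  have j: "j \<noteq> 0" using mobius_denominator_nonzero[OF det \<tau>] by (simp add: j_def)
  have "(\<Prod>n=1..N-1. klein_form 0 (of_int n / of_int N) ((of_int a * \<tau> + of_int b) / j) powi (- M)) =
        (\<Prod>n=1..N-1. j powi M * klein_form (of_int (n * c) / of_int N) (of_int (n * d) / of_int N) \<tau> powi (- M))"
  proof (intro prod.cong refl)
    fix n
    have "klein_form 0 (of_int n / of_int N) ((of_int a * \<tau> + of_int b) / j) =
            klein_form (of_int (n * c) / of_int N) (of_int (n * d) / of_int N) \<tau> / j"
      using klein_form_mobius[OF det \<tau>, folded j_def, of 0 "of_int n / of_int N"] by simp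
    then show "klein_form 0 (of_int n / of_int N) ((of_int a * \<tau> + of_int b) / j) powi (- M) =
        j powi M * klein_form (of_int (n * c) / of_int N) (of_int (n * d) / of_int N) \<tau> powi (- M)"
      by (simp add: power_int_divide_distrib power_int_minus) (simp add: divide_inverse)
  qed
  also have "\<dots> = (j powi M) ^ nat (N - 1) *
      (\<Prod>n=1..N-1. klein_form (of_int (n * c) / of_int N) (of_int (n * d) / of_int N) \<tau> powi (- M))"
    by (simp add: prod.distrib)
  also have "(j powi M) ^ nat (N - 1) = j powi (M * (N - 1))"
    using N by (simp add: power_int_power')
  finally show ?thesis
    using j unfolding slash_def abcd[symmetric] j_def[symmetric]
    by (simp add: power_int_minus)
qed

lemma of_int_divide_in_Ints_iff:
  assumes "N \<noteq> 0"
  shows "(of_int m / of_int N :: rat) \<in> \<int> \<longleftrightarrow> N dvd m"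
proof
  assume "(of_int m / of_int N :: rat) \<in> \<int>"
  then obtain i where "of_int m / of_int N = (of_int i :: rat)" by (elim Ints_cases)
  then have "of_int m = (of_int (N * i) :: rat)" using assms by (simp add: field_simps)
  then show "N dvd m" by (metis dvd_triv_left of_int_eq_iff)
next
  assume "N dvd m"
  then show "(of_int m / of_int N :: rat) \<in> \<int>" using assms by auto
qed

text \<open>
  An integral index vector would force \<open>N\<close> to divide both \<open>n * c\<close> and \<open>n * d\<close>, hence \<open>n\<close>, because the
  determinant is \<open>1\<close>.
\<close>

lemma slash_prod_klein_form_q_holomorphic:
  fixes N M :: int and A :: "int ^ 2 ^ 2"
  assumes A: "A \<in> SL2Z" and N: "N \<ge> 1" and M: "M \<ge> 0"
  obtains H where "H holomorphic_on ball 0 1"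
    "\<And>\<tau>. Im \<tau> > 0 \<Longrightarrow>
       slash (\<lambda>\<tau>. \<Prod>n=1..N-1. klein_form 0 (of_int n / of_int N) \<tau> powi (- M)) A (M * (N - 1)) \<tau> =
         H (e (\<tau> / of_nat (nat (2 * N ^ 2))))"
proof -
  define c d where cd: "c = A $ 2 $ 1" "d = A $ 2 $ 2"
  have "\<exists>H. H holomorphic_on ball 0 1 \<and>
          (\<forall>\<tau>. Im \<tau> > 0 \<longrightarrow> inverse (klein_form (of_int (n * c) / of_int N) (of_int (n * d) / of_int N) \<tau>) =
                 H (e (\<tau> / of_int (2 * N ^ 2))))" if n: "n \<in> {1..N-1}" for n
  proof -
    have "\<not> (N dvd n * c \<and> (of_int (n * d) / of_int N :: rat) \<in> \<int>)"
    proof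
      assume "N dvd n * c \<and> (of_int (n * d) / of_int N :: rat) \<in> \<int>"
      then have "N dvd n * c" "N dvd n * d"
        using of_int_divide_in_Ints_iff[of N "n * d"] N by simp_all
      then have "N dvd A $ 1 $ 1 * (n * d) - A $ 1 $ 2 * (n * c)" by simp
      also have "A $ 1 $ 1 * (n * d) - A $ 1 $ 2 * (n * c) = n * (A $ 1 $ 1 * d - A $ 1 $ 2 * c)"
        by (simp add: algebra_simps)
      also have "\<dots> = n" using SL2Z_det[OF A] by (simp add: cd)
      finally show False using n zdvd_imp_le[of N n] by simp
    qed
    moreover have "N > 0" using N by simp
    ultimately show ?thesis
      using inverse_klein_form_q_holomorphic[of N "n * c" "of_int (n * d) / of_int N" thesis for thesis]
      by blast
  qed
  then obtain H where H: "\<And>n. n \<in> {1..N-1} \<Longrightarrow> H n holomorphic_on ball 0 1"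
     "\<And>n \<tau>. n \<in> {1..N-1} \<Longrightarrow> Im \<tau> > 0 \<Longrightarrow>
        inverse (klein_form (of_int (n * c) / of_int N) (of_int (n * d) / of_int N) \<tau>) =
                 H n (e (\<tau> / of_int (2 * N ^ 2)))"
    by metis
  show thesis
  proof (rule that[of "\<lambda>w. \<Prod>n=1..N-1. H n w ^ nat M"])
    show "(\<lambda>w. \<Prod>n=1..N-1. H n w ^ nat M) holomorphic_on ball 0 1"
      by (intro holomorphic_intros H)
    fix \<tau> :: complex assume \<tau>: "Im \<tau> > 0"
    have inv: "x powi (- M) = inverse x ^ nat M" for x :: complex
      using M by (simp add: power_int_def power_inverse)
    have h: "of_nat (nat (2 * N ^ 2)) = (of_int (2 * N ^ 2) :: complex)" by simp
    show "slash (\<lambda>\<tau>. \<Prod>n=1..N-1. klein_form 0 (of_int n / of_int N) \<tau> powi (- M)) A (M * (N - 1)) \<tau> =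
            (\<Prod>n=1..N-1. H n (e (\<tau> / of_nat (nat (2 * N ^ 2)))) ^ nat M)"
      unfolding slash_prod_klein_form[OF A N \<tau>] unfolding cd[symmetric] inv h
      by (intro prod.cong refl) (simp only: H(2)[OF _ \<tau>])
  qed
qed

lemma sum_int_upto:
  fixes N :: int
  assumes "N \<ge> 1"
  shows "2 * (\<Sum>n=1..N-1. n) = N * (N - 1)"
    and "6 * (\<Sum>n=1..N-1. n ^ 2) = (N - 1) * N * (2 * N - 1)"
  using assms
proof (induction N rule: int_ge_induct)
  case (step N)
  have "{1..N + 1 - 1} = insert N {1..N-1}" using step.hyps by auto
  then have sums: "(\<Sum>n=1..N+1-1. n) = N + (\<Sum>n=1..N-1. n)"
    "(\<Sum>n=1..N+1-1. n ^ 2) = N ^ 2 + (\<Sum>n=1..N-1. n ^ 2)" by simp_all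
  show "2 * (\<Sum>n=1..N+1-1. n) = (N + 1) * (N + 1 - 1)"
    unfolding sums using step.IH(1) by (simp add: algebra_simps)
  show "6 * (\<Sum>n=1..N+1-1. n ^ 2) = (N + 1 - 1) * (N + 1) * (2 * (N + 1) - 1)"
    unfolding sums using step.IH(2) by (simp add: algebra_simps power2_eq_square)
qed simp_all

text \<open>
  Multiplication by \<open>d\<close> permutes the nonzero residues, so the remainders of \<open>d * n\<close> have the same sum
  as the numbers \<open>n\<close> themselves.
\<close>

lemma sum_floor_mult_div:
  fixes d N :: int
  assumes "coprime d N" and N: "N \<ge> 1"
  shows "2 * (\<Sum>n=1..N-1. d * n div N) = (d - 1) * (N - 1)"
proof -
  have atLeastLessThan: "{1..<N} = {1..N-1}" by auto
  have "(\<Sum>n=1..N-1. d * n mod N) = (\<Sum>n=1..N-1. n)"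
    using sum.reindex_bij_betw[OF bij_betw_int_remainders_mult[OF assms(1)], of "\<lambda>x. x"]
    by (simp add: atLeastLessThan)
  moreover have "d * (\<Sum>n=1..N-1. n) = N * (\<Sum>n=1..N-1. d * n div N) + (\<Sum>n=1..N-1. d * n mod N)"
    by (simp add: sum_distrib_left flip: sum.distrib)
  ultimately have "N * (\<Sum>n=1..N-1. d * n div N) = (d - 1) * (\<Sum>n=1..N-1. n)"
    by (simp add: left_diff_distrib)
  then have "N * (2 * (\<Sum>n=1..N-1. d * n div N)) = (d - 1) * (2 * (\<Sum>n=1..N-1. n))"
    by (simp add: algebra_simps)
  also have "\<dots> = N * ((d - 1) * (N - 1))"
    unfolding sum_int_upto(1)[OF N] by (simp add: algebra_simps)
  finally show ?thesis using N by simp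
qed

lemma e_sum: "e (\<Sum>x\<in>X. f x) = (\<Prod>x\<in>X. e (f x))"
  by (induction X rule: infinite_finite_induct) (simp_all add: e_add)

text \<open>
  If \<open>N\<close> divides the lower left entry, the index \<open>(0, n / N)\<close> is sent to an integral translate of
  \<open>(0, t n / N)\<close>, where \<open>t n\<close> is the residue of \<open>d * n\<close>. As \<open>t\<close> permutes the indices, only the
  product of the roots of unity \<open>e (\<theta> n)\<close> remains. Summing the \<open>\<theta> n\<close> gives \<open>N - 1\<close> times an integer
  divided by \<open>12\<close>; this is why the exponent has to satisfy \<open>12 dvd M * (N - 1)\<close>.
\<close>

lemma slash_prod_klein_form_Gamma0:
  fixes N M T :: int and A :: "int ^ 2 ^ 2"
  assumes A: "A \<in> Gamma0 N" and N: "N \<ge> 1" and M: "M * (N - 1) = 12 * T" and \<tau>: "Im \<tau> > 0"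
  shows "slash (\<lambda>\<tau>. \<Prod>n=1..N-1. klein_form 0 (of_int n / of_int N) \<tau> powi (- M)) A (M * (N - 1)) \<tau> =
    (\<Prod>n=1..N-1. klein_form 0 (of_int n / of_int N) \<tau> powi (- M))"
proof -
  define d where "d = A $ 2 $ 2"
  have A': "A \<in> SL2Z" and "N dvd A $ 2 $ 1"
    using A by (simp_all add: Gamma0_def cong_0_iff)
  then obtain c where c: "A $ 2 $ 1 = N * c" by (elim dvdE)
  have det: "A $ 1 $ 1 * d - A $ 1 $ 2 * (N * c) = 1"
    using SL2Z_det[OF A'] by (simp add: d_def c)
  have "coprime d N"
  proof (rule coprimeI)
    fix k assume "k dvd d" "k dvd N"
    then have "k dvd A $ 1 $ 1 * d - A $ 1 $ 2 * (N * c)" by simp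
    then show "is_unit k" by (simp only: det)
  qed
  define s where "s n = d * n div N" for n
  define t where "t n = d * n mod N" for n
  \<comment> \<open>the exponent in the translation law, reduced modulo integers: the term \<open>n * c * s n\<close> is dropped\<close>
  define \<theta> :: "int \<Rightarrow> complex" where
    "\<theta> n = (of_int (n * c) - of_int d * of_int c * of_int n ^ 2 / of_int N + of_int (s n)) / 2" for n
  have shift: "klein_form (of_int (n * (N * c)) / of_int N) (of_int (n * d) / of_int N) \<tau> =
                 e (\<theta> n) * klein_form 0 (of_int (t n) / of_int N) \<tau>" for n
  proof -
    have r1: "of_int (n * (N * c)) / of_int N = 0 + (of_int (n * c) :: rat)" using N by simp
    have "of_int (n * d) = (of_int (t n + N * s n) :: rat)"
      by (simp only: s_def t_def mod_mult_div_eq mult.commute)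
    then have r2: "of_int (n * d) / of_int N = of_int (t n) / of_int N + (of_int (s n) :: rat)"
      using N by (simp add: field_simps)
    have "of_rat (0 * of_int (s n) - of_int (t n) / of_int N * of_int (n * c) +
            of_int (n * c * s n + n * c + s n)) / 2 = \<theta> n + of_int (n * c * s n)"
    proof -
      have t: "of_int (t n) = (of_int d * of_int n - of_int N * of_int (s n) :: complex)"
        by (simp add: t_def s_def flip: of_int_mult of_int_diff minus_mult_div_eq_mod)
      show ?thesis
        using N by (simp add: \<theta>_def of_rat_add of_rat_diff of_rat_mult of_rat_divide t
            field_simps power2_eq_square)
    qed
    then show ?thesis
      unfolding r1 r2 klein_form_translate[OF \<tau>] by (simp only: e_add e_of_int) simp
  qed
  have "of_int M * (\<Sum>n=1..N-1. \<theta> n) = of_int (T * (3 * c * N - d * c * (2 * N - 1) + 3 * (d - 1)))"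
  proof -
    have MN: "of_int M * (of_int N - 1) = (12 * of_int T :: complex)"
      using arg_cong[OF M, of "of_int :: int \<Rightarrow> complex"] by simp
    define S1 S2 S3 :: complex where S: "S1 = of_int (\<Sum>n=1..N-1. n)"
      "S2 = of_int (\<Sum>n=1..N-1. n ^ 2)" "S3 = of_int (\<Sum>n=1..N-1. s n)"
    have "2 * S1 = of_int N * (of_int N - 1)"
      using arg_cong[OF sum_int_upto(1)[OF N], of "of_int :: int \<Rightarrow> complex"] by (simp add: S)
    moreover have "6 * S2 = (of_int N - 1) * of_int N * (2 * of_int N - 1)"
      using arg_cong[OF sum_int_upto(2)[OF N], of "of_int :: int \<Rightarrow> complex"] by (simp add: S)
    moreover have "2 * S3 = (of_int d - 1) * (of_int N - 1)"
      using arg_cong[OF sum_floor_mult_div[OF \<open>coprime d N\<close> N], of "of_int :: int \<Rightarrow> complex"]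
      by (simp add: S s_def)
    ultimately have S': "S1 = (of_int N - 1) * of_int N / 2"
      "S2 = (of_int N - 1) * of_int N * (2 * of_int N - 1) / 6"
      "S3 = (of_int N - 1) * (of_int d - 1) / 2"
      by (simp_all add: field_simps)
    have "(\<Sum>n=1..N-1. \<theta> n) = (of_int c * S1 - of_int d * of_int c * S2 / of_int N + S3) / 2"
      by (simp add: \<theta>_def S sum.distrib sum_subtractf sum_divide_distrib[symmetric]
          sum_distrib_left mult_ac)
    also have "\<dots> = (of_int N - 1) * (3 * of_int c * of_int N - of_int d * of_int c * (2 * of_int N - 1)
        + 3 * (of_int d - 1)) / 12"
      using N unfolding S' by (simp add: field_simps)
    finally have "of_int M * (\<Sum>n=1..N-1. \<theta> n) = of_int M * (of_int N - 1) *
       (3 * of_int c * of_int N - of_int d * of_int c * (2 * of_int N - 1) + 3 * (of_int d - 1)) / 12"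
      by simp
    then show ?thesis unfolding MN by simp
  qed
  then have factor: "(\<Prod>n=1..N-1. e (\<theta> n)) powi (- M) = 1"
    by (simp only: power_int_minus e_sum[symmetric] e_powi e_of_int) simp
  have atLeastLessThan: "{1..<N} = {1..N-1}" by auto
  have "(\<Prod>n=1..N-1. klein_form (of_int (n * (N * c)) / of_int N) (of_int (n * d) / of_int N) \<tau> powi (- M)) =
        (\<Prod>n=1..N-1. e (\<theta> n)) powi (- M) * (\<Prod>n=1..N-1. klein_form 0 (of_int (t n) / of_int N) \<tau> powi (- M))"
    unfolding shift power_int_mult_distrib prod.distrib
    by (induction rule: infinite_finite_induct) (simp_all add: power_int_mult_distrib)
  also have "\<dots> = (\<Prod>n=1..N-1. klein_form 0 (of_int n / of_int N) \<tau> powi (- M))"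
    using prod.reindex_bij_betw[OF bij_betw_int_remainders_mult[OF \<open>coprime d N\<close>],
        of "\<lambda>n. klein_form 0 (of_int n / of_int N) \<tau> powi (- M)"]
    by (simp add: factor t_def atLeastLessThan)
  finally show ?thesis
    unfolding slash_prod_klein_form[OF A' N \<tau>] c d_def .
qed

theorem theorem2p8:
  fixes N :: int
  assumes "N \<ge> 2"
  shows "modular_form_Gamma0 N (12 * (N - 1) div gcd 12 (N - 1))
           (\<lambda>\<tau>. \<Prod>n=1..N-1. klein_form 0 (of_int n / of_int N) \<tau> powi (- (12 div gcd 12 (N - 1))))"
proof -
  define g where "g = gcd 12 (N - 1)"
  define M where "M = 12 div g"
  define T where "T = (N - 1) div g"
  define f where "f = (\<lambda>\<tau>. \<Prod>n=1..N-1. klein_form 0 (of_int n / of_int N) \<tau> powi (- M))"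
  have N: "N \<ge> 1" using assms by simp
  have g: "g > 0" "g dvd 12" "g dvd N - 1" by (simp_all add: g_def)
  have weight: "12 * (N - 1) div g = M * (N - 1)"
    using g by (simp add: M_def dvd_div_mult)
  have M: "M \<ge> 0" using g by (simp add: M_def pos_imp_zdiv_nonneg_iff)
  have T: "M * (N - 1) = 12 * T"
    using g by (simp add: T_def div_mult_swap flip: weight)
  define h where "h = nat (2 * N ^ 2)"
  have h: "h > 0" using N by (simp add: h_def)
  have cusp: "\<exists>H. H holomorphic_on ball 0 1 \<and>
      (\<forall>\<tau>. Im \<tau> > 0 \<longrightarrow> slash f A (M * (N - 1)) \<tau> = H (e (\<tau> / of_nat h)))" if "A \<in> SL2Z" for A
    using slash_prod_klein_form_q_holomorphic[OF that N M] unfolding f_def h_def by metis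
  have "modular_form_Gamma0 N (M * (N - 1)) f"
    unfolding modular_form_Gamma0_def
  proof (intro conjI ballI)
    show inv: "slash f A (M * (N - 1)) \<tau> = f \<tau>" if "A \<in> Gamma0 N" "\<tau> \<in> upper_half_plane" for A \<tau>
      using slash_prod_klein_form_Gamma0[OF that(1) N T] that(2)
      by (simp add: f_def upper_half_plane_def)
    show "has_q_expansion (slash f A (M * (N - 1)))" if "A \<in> SL2Z" for A
      using cusp[OF that] h has_q_expansion_if_q_holomorphic by blast
    \<comment> \<open>holomorphy on the half plane comes from the cusp at infinity: the expansion there is global\<close>
    have one: "mat 1 \<in> Gamma0 N"
      by (simp add: Gamma0_def SL2Z_def) (simp add: mat_def)
    then have "mat 1 \<in> SL2Z" by (simp add: Gamma0_def)
    from cusp[OF this] obtain H where H: "H holomorphic_on ball 0 1"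
      "\<And>\<tau>. Im \<tau> > 0 \<Longrightarrow> slash f (mat 1) (M * (N - 1)) \<tau> = H (e (\<tau> / of_nat h))" by blast
    have "(\<lambda>\<tau>. H (e (\<tau> / of_nat h))) holomorphic_on upper_half_plane"
    proof (rule holomorphic_on_compose_gen[OF _ H(1), unfolded o_def])
      show "(\<lambda>\<tau>. e (\<tau> / of_nat h)) holomorphic_on upper_half_plane"
        using h by (intro holomorphic_intros) auto
      show "(\<lambda>\<tau>. e (\<tau> / of_nat h)) ` upper_half_plane \<subseteq> ball 0 1"
        using h by (auto simp: upper_half_plane_def intro!: norm_e_less_1 divide_pos_pos)
    qed
    then show "f holomorphic_on upper_half_plane"
      by (rule holomorphic_transform) (use H(2) inv[OF one] in \<open>auto simp: upper_half_plane_def\<close>)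
  qed
  then show ?thesis
    using weight by (simp only: f_def M_def g_def)
qed

end
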